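(* Let $\mathbf{G}=(X,G)$ be a locally countable Borel graph. Then $D_{SB}(\mathbf{G}) = D_B(\mathbf{G})$.
   Context: A Borel graph is a graph $\mathbf{G}=(X,G)$ whose vertex set $X$ is a standard Borel space and whose edge relation $G\subseteq X\times X$ (symmetric and irreflexive) is a Borel subset of the product space. It is locally countable if every vertex has at most countable degree. $\text{Aut}(\mathbf{G})$ denotes the group of all graph automorphisms of $\mathbf{G}$ and $\text{Aut}_B(\mathbf{G})$ the group of those automorphisms that are Borel maps $X\to X$. A Borel distinguishing coloring of $\mathbf{G}$ is a Borel map $c:X\to I$, where $I$ is a standard Borel space, such that for every $\varphi\in\text{Aut}(\mathbf{G})\setminus\{\text{id}\}$ there exists $x\in X$ with $c(x)\neq c(\varphi(x))$. A strictly Borel distinguishing coloring of $\mathbf{G}$ is a Borel map $c:X\to I$, where $I$ is a standard Borel space, such that for every $\varphi\in\text{Aut}_B(\mathbf{G})\setminus\{\text{id}\}$ there exists $x\in X$ with $c(x)\neq c(\varphi(x))$. (The colorings are not required to be proper vertex colorings.) The Borel distinguishing number $D_B(\mathbf{G})$ is the minimum of the cardinals $|I|$ over all standard Borel spaces $I$ for which there is a Borel distinguishing coloring $c:X\to I$. The strictly Borel distinguishing number $D_{SB}(\mathbf{G})$ is the minimum of the cardinals $|I|$ over all standard Borel spaces $I$ for which there is a strictly Borel distinguishing coloring $c:X\to I$. *)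

theory Defs
  imports "HOL-Analysis.Analysis"
begin

unbundle cardinal_syntax
no_notation elt_set_eq (infix "=o" 50)

text \<open>
  Measurable spaces are represented by the type of measures; only \<^term>\<open>space M\<close> and
  \<^term>\<open>sets M\<close> are ever used. The carrier may be a proper subset of the type, and
  may be empty.
\<close>

definition Polish_topology :: "'a topology \<Rightarrow> bool" where
  "Polish_topology T \<longleftrightarrow> completely_metrizable_space T \<and> separable_space T"

definition standard_borel :: "'a measure \<Rightarrow> bool" where
  "standard_borel M \<longleftrightarrow>
     (\<exists>T. Polish_topology T \<and> topspace T = space M \<and>
          sets M = sigma_sets (space M) {U. openin T U})"

definition borel_graph :: "'a measure \<Rightarrow> ('a \<times> 'a) set \<Rightarrow> bool" where
  "borel_graph X G \<longleftrightarrow>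
     standard_borel X \<and> G \<in> sets (X \<Otimes>\<^sub>M X) \<and> sym G \<and> irrefl G"

definition locally_countable :: "'a measure \<Rightarrow> ('a \<times> 'a) set \<Rightarrow> bool" where
  "locally_countable X G \<longleftrightarrow> (\<forall>x\<in>space X. countable {y \<in> space X. (x, y) \<in> G})"

text \<open>
  Automorphisms are \<^const>\<open>extensional\<close> functions, hence determined by their values on
  the carrier; the identity automorphism is \<^term>\<open>\<lambda>x\<in>space X. x\<close>.
\<close>

definition graph_Aut :: "'a measure \<Rightarrow> ('a \<times> 'a) set \<Rightarrow> ('a \<Rightarrow> 'a) set" where
  "graph_Aut X G =
     {\<phi> \<in> extensional (space X). bij_betw \<phi> (space X) (space X) \<and>
        (\<forall>x\<in>space X. \<forall>y\<in>space X. (x, y) \<in> G \<longleftrightarrow> (\<phi> x, \<phi> y) \<in> G)}"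

definition graph_Aut_B :: "'a measure \<Rightarrow> ('a \<times> 'a) set \<Rightarrow> ('a \<Rightarrow> 'a) set" where
  "graph_Aut_B X G = graph_Aut X G \<inter> measurable X X"

definition borel_distinguishing_coloring ::
    "'a measure \<Rightarrow> ('a \<times> 'a) set \<Rightarrow> 'c measure \<Rightarrow> ('a \<Rightarrow> 'c) \<Rightarrow> bool" where
  "borel_distinguishing_coloring X G I c \<longleftrightarrow>
     standard_borel I \<and> c \<in> measurable X I \<and>
     (\<forall>\<phi> \<in> graph_Aut X G - {\<lambda>x\<in>space X. x}. \<exists>x\<in>space X. c x \<noteq> c (\<phi> x))"

definition strictly_borel_distinguishing_coloring ::
    "'a measure \<Rightarrow> ('a \<times> 'a) set \<Rightarrow> 'c measure \<Rightarrow> ('a \<Rightarrow> 'c) \<Rightarrow> bool" where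
  "strictly_borel_distinguishing_coloring X G I c \<longleftrightarrow>
     standard_borel I \<and> c \<in> measurable X I \<and>
     (\<forall>\<phi> \<in> graph_Aut_B X G - {\<lambda>x\<in>space X. x}. \<exists>x\<in>space X. c x \<noteq> c (\<phi> x))"

text \<open>
  Cardinals are well-orders up to the relation \<open>=o\<close>. Since cardinals are well-ordered by
  \<open>\<le>o\<close>, a nonempty set of cardinals has a minimum, which is unique up to \<open>=o\<close>.
\<close>

definition min_cardinal :: "'c rel set \<Rightarrow> 'c rel" where
  "min_cardinal R = (SOME r. r \<in> R \<and> (\<forall>s\<in>R. r \<le>o s))"

text \<open>
  The minimum over all standard Borel spaces of colors is taken over those with carrier a
  subset of the reals, with an arbitrary standard Borel structure that need not be related to
  the usual one. This loses nothing: a standard Borel space on any type has a copy of this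
  kind (\<open>standard_borel_real_copy\<close>), so that the minimum is attained and is a lower
  bound for color spaces of every type (\<open>borel_distinguishing_number_attained\<close>,
  \<open>borel_distinguishing_number_le\<close>, and their strict versions).
\<close>

definition borel_distinguishing_number :: "'a measure \<Rightarrow> ('a \<times> 'a) set \<Rightarrow> real rel" where
  "borel_distinguishing_number X G =
     min_cardinal {|space I| | I::real measure. \<exists>c. borel_distinguishing_coloring X G I c}"

definition strictly_borel_distinguishing_number ::
    "'a measure \<Rightarrow> ('a \<times> 'a) set \<Rightarrow> real rel" where
  "strictly_borel_distinguishing_number X G =
     min_cardinal {|space I| | I::real measure. \<exists>c. strictly_borel_distinguishing_coloring X G I c}"

lemma standard_borel_image:
  fixes M :: "'a measure" and f :: "'a \<Rightarrow> 'b"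
  assumes M: "standard_borel M" and inj: "inj_on f (space M)"
  shows "\<exists>N. standard_borel N \<and> space N = f ` space M \<and> f \<in> measurable M N"
proof -
  obtain T where T: "completely_metrizable_space T" "separable_space T"
    and top: "topspace T = space M" and sets: "sets M = sigma_sets (space M) {U. openin T U}"
    using M unfolding standard_borel_def Polish_topology_def by blast
  define g where "g = the_inv_into (space M) f"
  define T' where "T' = pullback_topology (f ` space M) g T"
  define N where "N = sigma (f ` space M) {U. openin T' U}"
  have gf: "g (f x) = x" if "x \<in> space M" for x
    using that inj by (simp add: g_def the_inv_into_f_f)
  have top': "topspace T' = f ` space M"
    unfolding T'_def topspace_pullback_topology top using gf by auto
  have sub: "{U. openin T' U} \<subseteq> Pow (f ` space M)"
    using openin_subset top' by fastforce
  have pre: "f -` U \<inter> space M = V" if "U = g -` V \<inter> f ` space M" "openin T V" for U V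
    using that gf openin_subset[OF that(2)] top by (force dest: arg_cong[where f = g])
  have cf: "continuous_map T T' f"
    unfolding continuous_map_def top top'
  proof (intro conjI allI impI)
    fix U assume "openin T' U"
    then obtain V where V: "openin T V" "U = g -` V \<inter> f ` space M"
      unfolding T'_def openin_pullback_topology by blast
    have "{x \<in> space M. f x \<in> U} = V" using pre[OF V(2,1)] by auto
    then show "openin T {x \<in> space M. f x \<in> U}" using V by simp
  qed auto
  have cg: "continuous_map T' T g"
    unfolding continuous_map_def top top'
  proof (intro conjI allI impI)
    fix V assume "openin T V"
    moreover have "{x \<in> f ` space M. g x \<in> V} = g -` V \<inter> f ` space M" by auto
    ultimately show "openin T' {x \<in> f ` space M. g x \<in> V}"
      unfolding T'_def openin_pullback_topology by blast
  qed (use gf in auto)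
  have "T homeomorphic_space T'"
    unfolding homeomorphic_space_def homeomorphic_maps_def
    using cf cg gf top top' by fastforce
  then have "Polish_topology T'"
    unfolding Polish_topology_def
    using T homeomorphic_completely_metrizable_space homeomorphic_separable_space by blast
  moreover have spN: "space N = f ` space M" unfolding N_def using sub by simp
  moreover have "sets N = sigma_sets (f ` space M) {U. openin T' U}"
    unfolding N_def using sub by simp
  ultimately have "standard_borel N" unfolding standard_borel_def using top' by auto
  moreover have "f \<in> measurable M N"
    unfolding N_def
  proof (rule measurable_measure_of[OF sub])
    fix U assume "U \<in> {U. openin T' U}"
    then obtain V where V: "openin T V" "U = g -` V \<inter> f ` space M"
      unfolding T'_def openin_pullback_topology by blast
    then show "f -` U \<inter> space M \<in> sets M" using pre[OF V(2,1)] sets by auto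
  qed auto
  ultimately show ?thesis using spN by blast
qed

lemma standard_borel_inj_real:
  assumes "standard_borel M"
  shows "\<exists>f :: 'a \<Rightarrow> real. inj_on f (space (M :: 'a measure))"
proof -
  obtain T where T: "completely_metrizable_space T" "separable_space T"
    and top: "topspace T = space M"
    using assms unfolding standard_borel_def Polish_topology_def by blast
  obtain S d where "Metric_space S d" and TS: "T = Metric_space.mtopology S d"
    using T(1) unfolding completely_metrizable_space_def by blast
  then interpret Metric_space S d by simp
  have S: "S = space M" using top TS by simp
  obtain D where D: "countable D" "D \<subseteq> S" "mtopology closure_of D = S"
    using T(2) unfolding TS separable_space_def by auto
  define h where "h x = {(y, n). y \<in> D \<and> d x y < inverse (real (Suc n))}" for x
  have "inj_on h S"
  proof (rule inj_onI, rule ccontr)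
    fix x y assume xy: "x \<in> S" "y \<in> S" "h x = h y" "x \<noteq> y"
    then have "d x y > 0" by simp
    then obtain n where n: "inverse (real (Suc n)) < d x y / 2"
      using reals_Archimedean[of "d x y / 2"] by auto
    have "x \<in> mtopology closure_of D" using D xy by simp
    moreover have "0 < inverse (real (Suc n))" by simp
    ultimately obtain z where z: "z \<in> D" "z \<in> mball x (inverse (real (Suc n)))"
      unfolding metric_closure_of by blast
    then have "(z, n) \<in> h x" by (simp add: h_def del: of_nat_Suc)
    then have "(z, n) \<in> h y" using xy by simp
    then have "d x z < d x y / 2" "d y z < d x y / 2"
      using n z by (auto simp: h_def simp del: of_nat_Suc)
    moreover have "d x y \<le> d x z + d z y" using triangle xy z by auto
    ultimately show False by (simp add: commute[of z y])
  qed
  moreover have "\<exists>e :: 'a \<times> nat \<Rightarrow> nat. inj_on e (D \<times> UNIV)"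
    using countable_SIGMA[OF D(1), of "\<lambda>_. UNIV :: nat set"] by (auto simp: countable_def)
  then obtain e :: "'a \<times> nat \<Rightarrow> nat" where e: "inj_on e (D \<times> UNIV)" by blast
  have "inj_on ((`) e) (Pow (D \<times> UNIV))" using e by (rule inj_on_image_Pow)
  moreover have "h ` S \<subseteq> Pow (D \<times> UNIV)" by (auto simp: h_def)
  ultimately have 1: "inj_on ((`) e \<circ> h) S"
    by (meson comp_inj_on inj_on_subset)
  obtain k :: "nat set \<Rightarrow> real" where k: "inj k"
    using nat_sets_eqpoll_reals unfolding eqpoll_def bij_betw_def by blast
  have "inj_on (k \<circ> ((`) e \<circ> h)) S"
    using 1 k by (meson comp_inj_on inj_on_subset subset_UNIV)
  then show ?thesis using S by blast
qed

lemma standard_borel_real_copy: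
  fixes M :: "'a measure"
  assumes "standard_borel M"
  shows "\<exists>(f :: 'a \<Rightarrow> real) N. standard_borel N \<and> f \<in> measurable M N \<and> bij_betw f (space M) (space N)"
proof -
  obtain f :: "'a \<Rightarrow> real" where "inj_on f (space M)" using standard_borel_inj_real[OF assms] by blast
  then show ?thesis using standard_borel_image[OF assms, of f] by (auto simp: bij_betw_def)
qed

lemma borel_distinguishing_coloring_real_copy:
  fixes I :: "'c measure"
  assumes "borel_distinguishing_coloring X G I c"
  shows "\<exists>(J :: real measure) c'. borel_distinguishing_coloring X G J c' \<and> |space J| =o |space I|"
proof -
  have I: "standard_borel I" "c \<in> measurable X I"
    using assms by (auto simp: borel_distinguishing_coloring_def)
  obtain f :: "'c \<Rightarrow> real" and J where f: "standard_borel J" "f \<in> measurable I J"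
    and b: "bij_betw f (space I) (space J)"
    using standard_borel_real_copy[OF I(1)] by blast
  have "borel_distinguishing_coloring X G J (f \<circ> c)"
    unfolding borel_distinguishing_coloring_def
  proof (intro conjI ballI)
    fix \<phi> assume \<phi>: "\<phi> \<in> graph_Aut X G - {\<lambda>x\<in>space X. x}"
    then obtain x where x: "x \<in> space X" "c x \<noteq> c (\<phi> x)"
      using assms unfolding borel_distinguishing_coloring_def by blast
    have "\<phi> x \<in> space X" using \<phi> x by (auto simp: graph_Aut_def bij_betw_def)
    then have "c x \<in> space I" "c (\<phi> x) \<in> space I" using measurable_space[OF I(2)] x(1) by auto
    then show "\<exists>x\<in>space X. (f \<circ> c) x \<noteq> (f \<circ> c) (\<phi> x)"
      using x bij_betw_imp_inj_on[OF b] by (auto dest: inj_onD)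
  qed (use f(1) measurable_comp[OF I(2) f(2)] in auto)
  then show ?thesis using b card_of_ordIso ordIso_symmetric by blast
qed

lemma strictly_borel_distinguishing_coloring_real_copy:
  fixes I :: "'c measure"
  assumes "strictly_borel_distinguishing_coloring X G I c"
  shows "\<exists>(J :: real measure) c'.
           strictly_borel_distinguishing_coloring X G J c' \<and> |space J| =o |space I|"
proof -
  have I: "standard_borel I" "c \<in> measurable X I"
    using assms by (auto simp: strictly_borel_distinguishing_coloring_def)
  obtain f :: "'c \<Rightarrow> real" and J where f: "standard_borel J" "f \<in> measurable I J"
    and b: "bij_betw f (space I) (space J)"
    using standard_borel_real_copy[OF I(1)] by blast
  have "strictly_borel_distinguishing_coloring X G J (f \<circ> c)"
    unfolding strictly_borel_distinguishing_coloring_def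
  proof (intro conjI ballI)
    fix \<phi> assume \<phi>: "\<phi> \<in> graph_Aut_B X G - {\<lambda>x\<in>space X. x}"
    then obtain x where x: "x \<in> space X" "c x \<noteq> c (\<phi> x)"
      using assms unfolding strictly_borel_distinguishing_coloring_def by blast
    have "\<phi> x \<in> space X" using \<phi> x by (auto simp: graph_Aut_B_def graph_Aut_def bij_betw_def)
    then have "c x \<in> space I" "c (\<phi> x) \<in> space I" using measurable_space[OF I(2)] x(1) by auto
    then show "\<exists>x\<in>space X. (f \<circ> c) x \<noteq> (f \<circ> c) (\<phi> x)"
      using x bij_betw_imp_inj_on[OF b] by (auto dest: inj_onD)
  qed (use f(1) measurable_comp[OF I(2) f(2)] in auto)
  then show ?thesis using b card_of_ordIso ordIso_symmetric by blast
qed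

lemma borel_distinguishing_coloring_id:
  assumes "standard_borel X"
  shows "borel_distinguishing_coloring X G X (\<lambda>x. x)"
proof -
  have "\<exists>x\<in>space X. x \<noteq> \<phi> x" if "\<phi> \<in> graph_Aut X G - {\<lambda>x\<in>space X. x}" for \<phi>
  proof (rule ccontr)
    assume "\<not> (\<exists>x\<in>space X. x \<noteq> \<phi> x)"
    moreover have "\<phi> \<in> extensional (space X)" using that by (simp add: graph_Aut_def)
    ultimately have "\<phi> = (\<lambda>x\<in>space X. x)" by (auto intro!: extensionalityI[where A = "space X"])
    then show False using that by blast
  qed
  then show ?thesis using assms by (auto simp: borel_distinguishing_coloring_def)
qed

lemma borel_distinguishing_imp_strictly:
  "borel_distinguishing_coloring X G I c \<Longrightarrow> strictly_borel_distinguishing_coloring X G I c"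
  by (auto simp: borel_distinguishing_coloring_def strictly_borel_distinguishing_coloring_def
      graph_Aut_B_def)

lemma min_cardinal:
  assumes "R \<noteq> {}" "\<And>r. r \<in> R \<Longrightarrow> Card_order r"
  shows "min_cardinal R \<in> R" "s \<in> R \<Longrightarrow> min_cardinal R \<le>o s"
proof -
  have "\<exists>r. r \<in> R \<and> (\<forall>s\<in>R. r \<le>o s)"
    using exists_minim_Card_order[of R] assms by blast
  then have "min_cardinal R \<in> R \<and> (\<forall>s\<in>R. min_cardinal R \<le>o s)"
    unfolding min_cardinal_def by (rule someI_ex)
  then show "min_cardinal R \<in> R" "s \<in> R \<Longrightarrow> min_cardinal R \<le>o s" by auto
qed

lemma borel_distinguishing_number_attained:
  assumes "standard_borel X"
  shows "\<exists>(I :: real measure) c. borel_distinguishing_coloring X G I c \<and>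
           borel_distinguishing_number X G = |space I|"
proof -
  let ?R = "{|space I| | I::real measure. \<exists>c. borel_distinguishing_coloring X G I c}"
  have "?R \<noteq> {}"
    using borel_distinguishing_coloring_real_copy[OF borel_distinguishing_coloring_id[OF assms]]
    by blast
  then have "min_cardinal ?R \<in> ?R" by (rule min_cardinal) (auto intro: card_of_Card_order)
  then show ?thesis unfolding borel_distinguishing_number_def by auto
qed

lemma borel_distinguishing_number_le:
  fixes I :: "'c measure"
  assumes "borel_distinguishing_coloring X G I c"
  shows "borel_distinguishing_number X G \<le>o |space I|"
proof -
  let ?R = "{|space I| | I::real measure. \<exists>c. borel_distinguishing_coloring X G I c}"
  obtain J :: "real measure" where J: "|space J| \<in> ?R" "|space J| =o |space I|"
    using borel_distinguishing_coloring_real_copy[OF assms] by blast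
  then have "min_cardinal ?R \<le>o |space J|"
    by (intro min_cardinal) (auto intro: card_of_Card_order)
  then show ?thesis
    unfolding borel_distinguishing_number_def using J(2) ordLeq_ordIso_trans by blast
qed

lemma strictly_borel_distinguishing_number_attained:
  assumes "standard_borel X"
  shows "\<exists>(I :: real measure) c. strictly_borel_distinguishing_coloring X G I c \<and>
           strictly_borel_distinguishing_number X G = |space I|"
proof -
  let ?R = "{|space I| | I::real measure. \<exists>c. strictly_borel_distinguishing_coloring X G I c}"
  have "?R \<noteq> {}"
    using strictly_borel_distinguishing_coloring_real_copy
      [OF borel_distinguishing_imp_strictly[OF borel_distinguishing_coloring_id[OF assms]]]
    by blast
  then have "min_cardinal ?R \<in> ?R" by (rule min_cardinal) (auto intro: card_of_Card_order)
  then show ?thesis unfolding strictly_borel_distinguishing_number_def by auto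
qed

lemma strictly_borel_distinguishing_number_le:
  fixes I :: "'c measure"
  assumes "strictly_borel_distinguishing_coloring X G I c"
  shows "strictly_borel_distinguishing_number X G \<le>o |space I|"
proof -
  let ?R = "{|space I| | I::real measure. \<exists>c. strictly_borel_distinguishing_coloring X G I c}"
  obtain J :: "real measure" where J: "|space J| \<in> ?R" "|space J| =o |space I|"
    using strictly_borel_distinguishing_coloring_real_copy[OF assms] by blast
  then have "min_cardinal ?R \<le>o |space J|"
    by (intro min_cardinal) (auto intro: card_of_Card_order)
  then show ?thesis
    unfolding strictly_borel_distinguishing_number_def using J(2) ordLeq_ordIso_trans by blast
qed

end

theory Submission
  imports Defs
begin

text \<open>
  A strictly Borel distinguishing coloring of a locally countable Borel graph is already Borel
  distinguishing, so the two numbers are minima of the same set of cardinals. For suppose that a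
  nontrivial automorphism \<open>\<phi>\<close>, possibly not Borel, preserves the coloring, and let \<open>\<phi>\<close> move the
  point \<open>x\<close>. The connected component \<open>C\<close> of \<open>x\<close> is countable (\<open>countable_component\<close>), and \<open>\<phi>\<close>
  carries it onto the component \<open>D\<close> of \<open>\<phi> x\<close>, which is equal to \<open>C\<close> or disjoint from it. Keep only
  what \<open>\<phi>\<close> does to \<open>C\<close>: let \<open>\<psi>\<close> be \<open>\<phi>\<close> on \<open>C\<close>, the inverse of \<open>\<phi>\<close> on \<open>D\<close> if \<open>D \<noteq> C\<close>, and the
  identity elsewhere. As no edge leaves \<open>C\<close> or \<open>D\<close>, this is an automorphism
  (\<open>exchange_graph_Aut\<close>). It moves only countably many points, so it is Borel
  (\<open>measurable_countable_support\<close>); it preserves the coloring because \<open>\<phi>\<close> does; and it moves \<open>x\<close>.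
\<close>

section \<open>Countable modifications of the identity\<close>

lemma standard_borel_countable_sets:
  assumes X: "standard_borel X" and K: "countable K" "K \<subseteq> space X"
  shows "K \<in> sets X"
proof -
  obtain T where T: "completely_metrizable_space T" and top: "topspace T = space X"
    and sets: "sets X = sigma_sets (space X) {U. openin T U}"
    using X unfolding standard_borel_def Polish_topology_def by blast
  have "Hausdorff_space T"
    using T completely_metrizable_imp_metrizable_space metrizable_imp_Hausdorff_space by blast
  then have "{x} \<in> sets X" if "x \<in> space X" for x
  proof -
    have "closedin T {x}"
      using \<open>Hausdorff_space T\<close> that top by (simp add: closedin_Hausdorff_singleton)
    then have "space X - {x} \<in> sets X"
      unfolding sets closedin_def top by (auto intro: sigma_sets.Basic)
    then have "space X - (space X - {x}) \<in> sets X" by blast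
    moreover have "space X - (space X - {x}) = {x}" using that by blast
    ultimately show ?thesis by simp
  qed
  then have "(\<Union>x\<in>K. {x}) \<in> sets X" using K by (intro sets.countable_UN') auto
  then show ?thesis by simp
qed

text \<open>
  A preimage under \<open>f\<close> differs from the original set only inside the countable set \<open>K\<close>, where
  every subset is Borel.
\<close>
lemma measurable_countable_support:
  assumes X: "standard_borel X" and K: "countable K"
    and f: "f \<in> space X \<rightarrow> space X" and id: "\<And>x. x \<in> space X - K \<Longrightarrow> f x = x"
  shows "f \<in> measurable X X"
proof (rule measurableI)
  fix A assume A: "A \<in> sets X"
  have same: "f x \<in> A \<longleftrightarrow> x \<in> A" if "x \<in> space X" "x \<notin> K" for x
    using id that by simp
  have split: "f -` A \<inter> space X = (A - (K \<inter> space X)) \<union> (f -` A \<inter> space X \<inter> K)"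
    using same sets.sets_into_space[OF A] by blast
  have "K \<inter> space X \<in> sets X" "f -` A \<inter> space X \<inter> K \<in> sets X"
    using K by (auto intro!: standard_borel_countable_sets[OF X] intro: countable_subset)
  then show "f -` A \<inter> space X \<in> sets X" using A by (subst split) blast
qed (use f in auto)

section \<open>Connected components\<close>

lemma borel_graph_subset: "borel_graph X G \<Longrightarrow> G \<subseteq> space X \<times> space X"
  using sets.sets_into_space[of G "X \<Otimes>\<^sub>M X"] by (auto simp: borel_graph_def space_pair_measure)

lemma component_subset:
  assumes "G \<subseteq> V \<times> V" "x \<in> V"
  shows "G\<^sup>* `` {x} \<subseteq> V"
proof
  fix y assume "y \<in> G\<^sup>* `` {x}"
  then have "(x, y) \<in> G\<^sup>*" by simp
  then show "y \<in> V" using assms by (induction) auto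
qed

lemma countable_component:
  assumes G: "G \<subseteq> space X \<times> space X" and lc: "locally_countable X G"
  shows "countable (G\<^sup>* `` {x})"
proof -
  have nbhd: "countable (G `` {y})" for y
  proof (cases "y \<in> space X")
    case True
    moreover have "G `` {y} = {z \<in> space X. (y, z) \<in> G}" using G by auto
    ultimately show ?thesis using lc by (simp add: locally_countable_def)
  next
    case False
    then have "G `` {y} = {}" using G by auto
    then show ?thesis by simp
  qed
  have "countable ((G ^^ n) `` {x})" for n
  proof (induction n)
    case (Suc n)
    have "(G ^^ Suc n) `` {x} = (\<Union>y\<in>(G ^^ n) `` {x}. G `` {y})" by auto
    then show ?case using Suc nbhd by auto
  qed simp
  moreover have "G\<^sup>* `` {x} = (\<Union>n. (G ^^ n) `` {x})" by (auto simp: rtrancl_is_UN_relpow)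
  ultimately show ?thesis by simp
qed

lemma component_eq_or_disjoint:
  assumes "sym G"
  shows "G\<^sup>* `` {x} = G\<^sup>* `` {y} \<or> G\<^sup>* `` {x} \<inter> G\<^sup>* `` {y} = {}"
proof -
  have "equiv UNIV (G\<^sup>*)"
    using assms by (intro equivI) (auto simp: refl_rtrancl sym_rtrancl trans_rtrancl)
  then show ?thesis by (rule quotient_disj) (auto intro: quotientI)
qed

lemma graph_Aut_image_component:
  assumes G: "G \<subseteq> space X \<times> space X" and \<phi>: "\<phi> \<in> graph_Aut X G" and x: "x \<in> space X"
  shows "\<phi> ` (G\<^sup>* `` {x}) = G\<^sup>* `` {\<phi> x}"
proof (intro equalityI subsetI)
  have edge: "(y, z) \<in> G \<longleftrightarrow> (\<phi> y, \<phi> z) \<in> G" if "y \<in> space X" "z \<in> space X" for y z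
    using \<phi> that unfolding graph_Aut_def by blast
  have onto: "\<phi> ` space X = space X" using \<phi> by (auto simp: graph_Aut_def bij_betw_def)
  {
    fix z assume "z \<in> \<phi> ` (G\<^sup>* `` {x})"
    then obtain y where "(x, y) \<in> G\<^sup>*" and z: "z = \<phi> y" by auto
    from this(1) have "(\<phi> x, \<phi> y) \<in> G\<^sup>*"
    proof (induction)
      case (step y z)
      then have "(\<phi> y, \<phi> z) \<in> G" using G edge by blast
      then show ?case using step.IH by simp
    qed simp
    then show "z \<in> G\<^sup>* `` {\<phi> x}" using z by simp
  next
    fix z assume "z \<in> G\<^sup>* `` {\<phi> x}"
    then have "(\<phi> x, z) \<in> G\<^sup>*" by simp
    then show "z \<in> \<phi> ` (G\<^sup>* `` {x})"
    proof (induction)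
      case (step y z)
      then obtain u where u: "y = \<phi> u" "(x, u) \<in> G\<^sup>*" by auto
      obtain v where v: "z = \<phi> v" "v \<in> space X" using step.hyps(2) G onto by blast
      have "u \<in> space X" using component_subset[OF G x] u(2) by auto
      then have "(u, v) \<in> G" using edge step.hyps(2) u v by simp
      then show ?case using u v by (auto intro: rtrancl_into_rtrancl)
    qed auto
  }
qed

section \<open>Exchanging a component with its image\<close>

text \<open>
  Let \<open>\<phi>\<close> be a bijection of \<open>V\<close> and \<open>C \<subseteq> V\<close>. If \<open>C\<close> is its own image under \<open>\<phi>\<close>, the second branch
  is never taken and the map is \<open>\<phi>\<close> on \<open>C\<close>; if \<open>C\<close> is disjoint from its image, the map is an
  involution that exchanges the two sets.
\<close>
definition exchange :: "'a set \<Rightarrow> 'a set \<Rightarrow> ('a \<Rightarrow> 'a) \<Rightarrow> 'a \<Rightarrow> 'a" where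
  "exchange V C \<phi> =
     (\<lambda>y\<in>V. if y \<in> C then \<phi> y else if y \<in> \<phi> ` C then inv_into V \<phi> y else y)"

lemma exchange_bij_betw:
  assumes \<phi>: "bij_betw \<phi> V V" and C: "C \<subseteq> V"
    and disj: "\<phi> ` C = C \<or> C \<inter> \<phi> ` C = {}"
  shows "bij_betw (exchange V C \<phi>) V V"
proof -
  let ?\<psi> = "exchange V C \<phi>" and ?D = "\<phi> ` C"
  have D: "?D \<subseteq> V" using C \<phi> by (auto simp: bij_betw_def)
  have CD: "bij_betw ?\<psi> C ?D"
  proof -
    have "bij_betw \<phi> C ?D" using \<phi> C by (auto simp: bij_betw_def intro: inj_on_subset)
    moreover have "?\<psi> y = \<phi> y" if "y \<in> C" for y using that C by (auto simp: exchange_def)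
    ultimately show ?thesis using bij_betw_cong[of _ ?\<psi>] by blast
  qed
  have DC: "bij_betw ?\<psi> ?D C" if "C \<inter> ?D = {}"
  proof -
    have "bij_betw (inv_into V \<phi>) ?D C"
      using \<phi> C by (metis bij_betw_def bij_betw_inv_into_subset)
    moreover have "?\<psi> y = inv_into V \<phi> y" if "y \<in> ?D" for y
      using that \<open>C \<inter> ?D = {}\<close> D by (auto simp: exchange_def)
    ultimately show ?thesis using bij_betw_cong[of _ ?\<psi>] by blast
  qed
  have union: "bij_betw ?\<psi> (C \<union> ?D) (C \<union> ?D)"
    using disj
  proof
    assume "?D = C" then show ?thesis using CD by simp
  next
    assume d: "C \<inter> ?D = {}"
    have "bij_betw ?\<psi> (C \<union> ?D) (?D \<union> C)"
      using CD DC[OF d] by (rule bij_betw_combine) (use d in blast)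
    then show ?thesis by (simp add: Un_commute)
  qed
  have rest: "bij_betw ?\<psi> (V - (C \<union> ?D)) (V - (C \<union> ?D))"
    unfolding bij_betw_def inj_on_def by (force simp: exchange_def)
  have "V = (C \<union> ?D) \<union> (V - (C \<union> ?D))" using C D by blast
  then show ?thesis using bij_betw_combine[OF union rest] by auto
qed

text \<open>
  No edge leaves \<open>C\<close> or its image, so the pieces on which the exchange map is given by
  different formulas have no edges between them, and neither have their images. On each piece
  the formula preserves and reflects edges.
\<close>
lemma exchange_graph_Aut:
  assumes \<phi>: "\<phi> \<in> graph_Aut X G" and C: "C \<subseteq> space X"
    and disj: "\<phi> ` C = C \<or> C \<inter> \<phi> ` C = {}"
    and inv_C: "\<And>y z. (y, z) \<in> G \<Longrightarrow> y \<in> C \<longleftrightarrow> z \<in> C"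
    and inv_D: "\<And>y z. (y, z) \<in> G \<Longrightarrow> y \<in> \<phi> ` C \<longleftrightarrow> z \<in> \<phi> ` C"
  shows "exchange (space X) C \<phi> \<in> graph_Aut X G"
proof -
  define D where "D = \<phi> ` C"
  define \<psi> where "\<psi> = exchange (space X) C \<phi>"
  let ?i = "inv_into (space X) \<phi>"
  note inv_D' = inv_D[folded D_def]
  have disj': "(\<forall>v. v \<in> C \<longleftrightarrow> v \<in> D) \<or> (\<forall>v. v \<in> C \<longrightarrow> v \<notin> D)"
    using disj unfolding D_def[symmetric] by blast
  have bij: "bij_betw \<phi> (space X) (space X)" using \<phi> by (simp add: graph_Aut_def)
  have inj: "inj_on \<phi> (space X)" using bij by (simp add: bij_betw_def)
  have edge: "(y, z) \<in> G \<longleftrightarrow> (\<phi> y, \<phi> z) \<in> G" if "y \<in> space X" "z \<in> space X" for y z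
    using \<phi> that unfolding graph_Aut_def by blast
  have i: "?i y \<in> C" "\<phi> (?i y) = y" if "y \<in> D" for y
    using that C inj by (auto simp: D_def)
  have on_C: "\<psi> y = \<phi> y" if "y \<in> C" for y
    using that C by (auto simp: \<psi>_def exchange_def)
  have on_D: "\<psi> y = ?i y" if "y \<in> D" "y \<notin> C" "y \<in> space X" for y
    using that by (auto simp: \<psi>_def D_def exchange_def)
  have off: "\<psi> y = y" if "y \<notin> C" "y \<notin> D" "y \<in> space X" for y
    using that by (auto simp: \<psi>_def D_def exchange_def)
  have edges: "(y, z) \<in> G \<longleftrightarrow> (\<psi> y, \<psi> z) \<in> G" if yz: "y \<in> space X" "z \<in> space X" for y z
  proof (cases "(y \<in> C \<longleftrightarrow> z \<in> C) \<and> (y \<in> D \<longleftrightarrow> z \<in> D)")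
    case True
    consider "y \<in> C" "z \<in> C" | "y \<notin> C" "z \<notin> C" "y \<in> D" "z \<in> D"
      | "y \<notin> C" "z \<notin> C" "y \<notin> D" "z \<notin> D" using True by blast
    then show ?thesis
    proof cases
      case 1
      then show ?thesis by (simp only: on_C edge[OF yz])
    next
      case 2
      then have "?i y \<in> space X" "?i z \<in> space X" using i(1) C by blast+
      from edge[OF this] have "(?i y, ?i z) \<in> G \<longleftrightarrow> (y, z) \<in> G"
        by (simp only: i(2)[OF 2(3)] i(2)[OF 2(4)])
      then show ?thesis by (simp only: on_D 2 yz not_False_eq_True)
    next
      case 3
      then show ?thesis by (simp only: off yz not_False_eq_True)
    qed
  next
    case False
    then have "(y, z) \<notin> G" using inv_C[of y z] inv_D'[of y z] by blast
    moreover have "(\<psi> y, \<psi> z) \<notin> G"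
    proof
      assume e: "(\<psi> y, \<psi> z) \<in> G"
      \<comment> \<open>The exchange map swaps membership in the two sets, so a pair of points that they
        separate is mapped to another such pair.\<close>
      have swap: "(\<psi> u \<in> C \<longleftrightarrow> u \<in> D) \<and> (\<psi> u \<in> D \<longleftrightarrow> u \<in> C)" if u: "u \<in> space X" for u
      proof -
        consider "u \<in> C" | "u \<notin> C" "u \<in> D" | "u \<notin> C" "u \<notin> D" by blast
        then show ?thesis
        proof cases
          case 1
          then have "\<psi> u \<in> D" by (simp add: on_C D_def)
          then show ?thesis using 1 disj' by blast
        next
          case 2
          then have "\<psi> u \<in> C" using i(1) u by (simp add: on_D)
          then show ?thesis using 2 disj' by blast
        next
          case 3
          then show ?thesis using off u by simp
        qed
      qed
      show False using inv_C[OF e] inv_D'[OF e] swap[OF yz(1)] swap[OF yz(2)] False by blast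
    qed
    ultimately show ?thesis by blast
  qed
  show ?thesis
    unfolding graph_Aut_def \<psi>_def[symmetric]
  proof (intro CollectI conjI ballI)
    show "\<psi> \<in> extensional (space X)" by (simp add: \<psi>_def exchange_def)
    show "bij_betw \<psi> (space X) (space X)"
      unfolding \<psi>_def by (rule exchange_bij_betw[OF bij C disj])
  qed (rule edges)
qed

section \<open>Equality of the distinguishing numbers\<close>

lemma strictly_borel_distinguishing_imp_borel_distinguishing:
  assumes XG: "borel_graph X G" "locally_countable X G"
    and c: "strictly_borel_distinguishing_coloring X G I c"
  shows "borel_distinguishing_coloring X G I c"
proof -
  have X: "standard_borel X" and "sym G" using XG(1) by (auto simp: borel_graph_def)
  note G = borel_graph_subset[OF XG(1)]
  have "\<exists>x\<in>space X. c x \<noteq> c (\<phi> x)" if \<phi>: "\<phi> \<in> graph_Aut X G" "\<phi> \<noteq> (\<lambda>x\<in>space X. x)" for \<phi>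
  proof (rule ccontr)
    assume "\<not> ?thesis"
    then have preserved: "c (\<phi> x) = c x" if "x \<in> space X" for x using that by metis
    have bij: "bij_betw \<phi> (space X) (space X)" and "\<phi> \<in> extensional (space X)"
      using \<phi> by (auto simp: graph_Aut_def)
    then obtain x where x: "x \<in> space X" "\<phi> x \<noteq> x"
      using \<phi>(2) extensionalityI[of \<phi> "space X" "\<lambda>x\<in>space X. x"] by auto
    define C where "C = G\<^sup>* `` {x}"
    define \<psi> where "\<psi> = exchange (space X) C \<phi>"
    have D: "\<phi> ` C = G\<^sup>* `` {\<phi> x}"
      using graph_Aut_image_component[OF G \<phi>(1) x(1)] by (simp add: C_def)
    have CX: "C \<subseteq> space X" unfolding C_def by (rule component_subset[OF G x(1)])
    have edge_inv: "y \<in> G\<^sup>* `` {u} \<longleftrightarrow> z \<in> G\<^sup>* `` {u}" if "(y, z) \<in> G" for y z u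
      using rtrancl_into_rtrancl[of u _ G] that symD[OF \<open>sym G\<close> that] by blast
    have aut: "\<psi> \<in> graph_Aut X G"
      unfolding \<psi>_def
    proof (rule exchange_graph_Aut[OF \<phi>(1) CX])
      show "\<phi> ` C = C \<or> C \<inter> \<phi> ` C = {}"
        unfolding D unfolding C_def using component_eq_or_disjoint[OF \<open>sym G\<close>, of x "\<phi> x"]
        by metis
    qed (unfold D, unfold C_def, (erule edge_inv)+)
    have "countable C" unfolding C_def by (rule countable_component[OF G XG(2)])
    then have "countable (C \<union> \<phi> ` C)" by simp
    moreover have "\<psi> \<in> space X \<rightarrow> space X" using aut by (auto simp: graph_Aut_def bij_betw_def)
    ultimately have "\<psi> \<in> measurable X X"
      by (rule measurable_countable_support[OF X]) (auto simp: \<psi>_def exchange_def)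
    then have "\<psi> \<in> graph_Aut_B X G" using aut by (simp add: graph_Aut_B_def)
    moreover have "\<psi> x \<noteq> x" using x by (simp add: \<psi>_def exchange_def C_def)
    then have "\<psi> \<noteq> (\<lambda>x\<in>space X. x)" using x(1) by auto
    ultimately obtain y where y: "y \<in> space X" "c y \<noteq> c (\<psi> y)"
      using c unfolding strictly_borel_distinguishing_coloring_def by blast
    have "c (inv_into (space X) \<phi> y) = c y"
      using preserved[of "inv_into (space X) \<phi> y"] bij y(1)
      by (simp add: bij_betw_def inv_into_into f_inv_into_f)
    then have "c (\<psi> y) = c y" using preserved y(1) by (simp add: \<psi>_def exchange_def)
    then show False using y(2) by simp
  qed
  then show ?thesis
    using c by (auto simp: borel_distinguishing_coloring_def
        strictly_borel_distinguishing_coloring_def)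
qed

theorem proposition1:
  fixes X :: "'a measure" and G :: "('a \<times> 'a) set"
  assumes "borel_graph X G" and "locally_countable X G"
  shows "strictly_borel_distinguishing_number X G =o borel_distinguishing_number X G"
proof -
  have "strictly_borel_distinguishing_coloring X G I c \<longleftrightarrow> borel_distinguishing_coloring X G I c"
    for I :: "real measure" and c
    using strictly_borel_distinguishing_imp_borel_distinguishing[OF assms]
      borel_distinguishing_imp_strictly by blast
  then have "strictly_borel_distinguishing_number X G = borel_distinguishing_number X G"
    by (simp add: strictly_borel_distinguishing_number_def borel_distinguishing_number_def)
  moreover have "standard_borel X" using assms(1) by (simp add: borel_graph_def)
  then obtain I :: "real measure" where "borel_distinguishing_number X G = |space I|"
    using borel_distinguishing_number_attained by blast
  ultimately show ?thesis using card_of_refl by metis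
qed

end
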